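(* Let $\mathcal{F}=\langle X,R^+,R^-\rangle$ be a collectively connected symmetric signed frame. Then $\mathcal{F}$ has the local balance property if and only if both $R^+$ and $R^-$ are collusive.
   Context: A symmetric signed frame is a tuple $\langle X,R^+,R^-\rangle$ with $X$ a set and $R^+,R^-\subseteq X\times X$ such that: $R^+$ is reflexive and symmetric; $R^-$ is symmetric; and $R^+,R^-$ are non-overlapping, i.e. $\forall x,y\in X.\ \neg(xR^+y)\vee\neg(xR^-y)$. It is collectively connected if moreover $\forall x,y\in X.\ (xR^+y \vee xR^-y)$. It has the local balance property (is balanced) iff for all $x,y,z\in X$: (1) $((xR^+y\wedge yR^+z)\vee(xR^-y\wedge yR^-z))\Rightarrow xR^+z$, and (2) $((xR^+y\wedge yR^-z)\vee(xR^-y\wedge yR^+z))\Rightarrow xR^-z$. A relation $S$ on $X$ is collusive iff $\forall x,y,z,w\in X\,\big((xSy\wedge xSz\wedge wSy)\Rightarrow wSz\big)$. *)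

theory Defs
  imports Main
begin

(* refl_on does not confine a relation to its carrier, hence the explicit inclusions. *)
definition symmetric_signed_frame :: "'a set \<Rightarrow> 'a rel \<Rightarrow> 'a rel \<Rightarrow> bool" where
  "symmetric_signed_frame X Rpos Rneg \<longleftrightarrow>
     Rpos \<subseteq> X \<times> X \<and> Rneg \<subseteq> X \<times> X \<and>
     refl_on X Rpos \<and> sym_on X Rpos \<and> sym_on X Rneg \<and>
     (\<forall>x\<in>X. \<forall>y\<in>X. (x, y) \<notin> Rpos \<or> (x, y) \<notin> Rneg)"

definition collectively_connected :: "'a set \<Rightarrow> 'a rel \<Rightarrow> 'a rel \<Rightarrow> bool" where
  "collectively_connected X Rpos Rneg \<longleftrightarrow>
     (\<forall>x\<in>X. \<forall>y\<in>X. (x, y) \<in> Rpos \<or> (x, y) \<in> Rneg)"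

definition locally_balanced :: "'a set \<Rightarrow> 'a rel \<Rightarrow> 'a rel \<Rightarrow> bool" where
  "locally_balanced X Rpos Rneg \<longleftrightarrow>
     (\<forall>x\<in>X. \<forall>y\<in>X. \<forall>z\<in>X.
        (((x, y) \<in> Rpos \<and> (y, z) \<in> Rpos) \<or> ((x, y) \<in> Rneg \<and> (y, z) \<in> Rneg)
           \<longrightarrow> (x, z) \<in> Rpos) \<and>
        (((x, y) \<in> Rpos \<and> (y, z) \<in> Rneg) \<or> ((x, y) \<in> Rneg \<and> (y, z) \<in> Rpos)
           \<longrightarrow> (x, z) \<in> Rneg))"

definition collusive_on :: "'a set \<Rightarrow> 'a rel \<Rightarrow> bool" where
  "collusive_on X S \<longleftrightarrow>
     (\<forall>x\<in>X. \<forall>y\<in>X. \<forall>z\<in>X. \<forall>w\<in>X.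
        (x, y) \<in> S \<and> (x, z) \<in> S \<and> (w, y) \<in> S \<longrightarrow> (w, z) \<in> S)"

end

theory Submission
  imports Defs
begin

text \<open>On \<open>X\<close>, connectedness and non-overlap make \<open>Rneg\<close> the
  complement of \<open>Rpos\<close> (\<open>neg_iff\<close>). Under balance, two edges of equal sign
  compose to a positive edge, and a positive edge followed by an edge keeps the latter's sign;
  together these give collusiveness for either sign. Conversely, collusiveness of
  \<open>Rpos\<close> with reflexivity gives transitivity (\<open>tpos\<close>), and the mixed
  balance cases follow by complementation. Only the negative-negative case needs collusiveness of
  \<open>Rneg\<close>.\<close>

theorem mainTheorem7:
  fixes X :: "'a set" and Rpos Rneg :: "'a rel"
  assumes "symmetric_signed_frame X Rpos Rneg"
    and "collectively_connected X Rpos Rneg"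
  shows "locally_balanced X Rpos Rneg \<longleftrightarrow> collusive_on X Rpos \<and> collusive_on X Rneg"
proof -
  have rpos: "(x, x) \<in> Rpos" if "x \<in> X" for x
    using assms(1) that by (auto simp: symmetric_signed_frame_def refl_on_def)
  have spos: "(y, x) \<in> Rpos" if "(x, y) \<in> Rpos" "x \<in> X" "y \<in> X" for x y
    using assms(1) that by (auto simp: symmetric_signed_frame_def sym_on_def)
  have sneg: "(y, x) \<in> Rneg" if "(x, y) \<in> Rneg" "x \<in> X" "y \<in> X" for x y
    using assms(1) that by (auto simp: symmetric_signed_frame_def sym_on_def)
  have neg_iff: "(x, y) \<in> Rneg \<longleftrightarrow> (x, y) \<notin> Rpos" if "x \<in> X" "y \<in> X" for x y
    using assms that by (auto simp: symmetric_signed_frame_def collectively_connected_def)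
  show ?thesis
  proof
    assume bal: "locally_balanced X Rpos Rneg"
    have "(w, z) \<in> Rpos"
      if "x \<in> X" "y \<in> X" "z \<in> X" "w \<in> X" "(x, y) \<in> Rpos" "(x, z) \<in> Rpos" "(w, y) \<in> Rpos"
      for x y z w
    proof -
      have "(w, x) \<in> Rpos"
        using bal that spos[of x y] unfolding locally_balanced_def by blast
      then show ?thesis
        using bal that unfolding locally_balanced_def by blast
    qed
    moreover have "(w, z) \<in> Rneg"
      if "x \<in> X" "y \<in> X" "z \<in> X" "w \<in> X" "(x, y) \<in> Rneg" "(x, z) \<in> Rneg" "(w, y) \<in> Rneg"
      for x y z w
    proof -
      \<comment> \<open>The path \<open>w\<close>, \<open>y\<close>, \<open>x\<close> has two
        negative edges, so its endpoints are positively related; the negative edge to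
        \<open>z\<close> then transfers from \<open>x\<close> to \<open>w\<close>.\<close>
      have "(w, x) \<in> Rpos"
        using bal that sneg[of x y] unfolding locally_balanced_def by blast
      then show ?thesis
        using bal that unfolding locally_balanced_def by blast
    qed
    ultimately show "collusive_on X Rpos \<and> collusive_on X Rneg"
      unfolding collusive_on_def by blast
  next
    assume col: "collusive_on X Rpos \<and> collusive_on X Rneg"
    have tpos: "(x, z) \<in> Rpos"
      if "x \<in> X" "y \<in> X" "z \<in> X" "(x, y) \<in> Rpos" "(y, z) \<in> Rpos" for x y z
      \<comment> \<open>Collusiveness is applied to the loop at \<open>y\<close>: from
        \<open>(y, y)\<close>, \<open>(y, z)\<close> and \<open>(x, y)\<close> it yields
        \<open>(x, z)\<close>.\<close>
      using col that rpos[of y] unfolding collusive_on_def by blast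
    have "(x, z) \<in> Rpos"
      if "x \<in> X" "y \<in> X" "z \<in> X" "(x, y) \<in> Rneg" "(y, z) \<in> Rneg" for x y z
    proof (rule ccontr)
      assume "(x, z) \<notin> Rpos"
      then have "(z, x) \<in> Rneg"
        using neg_iff sneg that by blast
      \<comment> \<open>A negative triangle would, by collusiveness, produce a negative loop at z.\<close>
      then have "(z, z) \<in> Rneg"
        using col that sneg[of x y] unfolding collusive_on_def by blast
      then show False
        using neg_iff rpos that by blast
    qed
    moreover have "(x, z) \<in> Rneg"
      if "x \<in> X" "y \<in> X" "z \<in> X" "(x, y) \<in> Rpos" "(y, z) \<in> Rneg" for x y z
      \<comment> \<open>If \<open>(x, z)\<close> were positive, the path \<open>y\<close>,
        \<open>x\<close>, \<open>z\<close> would make \<open>(y, z)\<close> positive.\<close>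
      using tpos[of y x z] spos[of x y] neg_iff that by blast
    moreover have "(x, z) \<in> Rneg"
      if "x \<in> X" "y \<in> X" "z \<in> X" "(x, y) \<in> Rneg" "(y, z) \<in> Rpos" for x y z
      using tpos[of x z y] spos[of y z] neg_iff that by blast
    ultimately show "locally_balanced X Rpos Rneg"
      using tpos unfolding locally_balanced_def by blast
  qed
qed

end
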